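(* Let $G$ be an $n$-vertex connected graph that is Class 0 and has diameter at least $3$. Then $e(G)\ge \frac53 n-\frac{11}{3}$.
   Context: Graphs are finite, simple and connected; $e(G)$ is the number of edges of $G$. A configuration on $G$ is a function $p:V(G)\to\mathbb{N}\cup\{0\}$ (number of pebbles on each vertex); its size is $|p|=\sum_{v}p(v)$. A pebbling move removes two pebbles from some vertex and places one pebble on an adjacent vertex. For a root $r\in V(G)$, $p$ is solvable for $(G,r)$ if some (possibly empty) sequence of pebbling moves from $p$ yields a configuration with at least one pebble on $r$. The pebbling number $\pi(G)$ is the least integer $k$ such that for every vertex $v$, every configuration of size $k$ is solvable for $(G,v)$. $G$ is Class 0 if $\pi(G)=|V(G)|$. *)

theory Defs
  imports Complex_Main
begin

text \<open>A graph is given by its vertex set and its set of edges, each edge being a two-element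
  set of vertices; so loops and multiple edges are excluded by the representation.\<close>

definition simple_graph :: "'a set \<Rightarrow> 'a set set \<Rightarrow> bool" where
  "simple_graph V E \<longleftrightarrow>
     finite V \<and> V \<noteq> {} \<and> (\<forall>e\<in>E. \<exists>u\<in>V. \<exists>v\<in>V. u \<noteq> v \<and> e = {u, v})"

definition adjacent :: "'a set set \<Rightarrow> 'a \<Rightarrow> 'a \<Rightarrow> bool" where
  "adjacent E u v \<longleftrightarrow> {u, v} \<in> E"

definition connected_graph :: "'a set \<Rightarrow> 'a set set \<Rightarrow> bool" where
  "connected_graph V E \<longleftrightarrow>
     simple_graph V E \<and> (\<forall>u\<in>V. \<forall>v\<in>V. (adjacent E)\<^sup>*\<^sup>* u v)"

text \<open>The relational power relates \<open>u\<close> to \<open>v\<close> iff there is a walk of length \<open>k\<close> from \<open>u\<close>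
  to \<open>v\<close>. The distance and the diameter are meaningful for connected graphs only.\<close>

definition graph_dist :: "'a set set \<Rightarrow> 'a \<Rightarrow> 'a \<Rightarrow> nat" where
  "graph_dist E u v = (LEAST k. (adjacent E ^^ k) u v)"

definition graph_diameter :: "'a set \<Rightarrow> 'a set set \<Rightarrow> nat" where
  "graph_diameter V E = Max {graph_dist E u v | u v. u \<in> V \<and> v \<in> V}"

text \<open>Configurations are functions on the whole type that vanish outside the vertex set.\<close>

definition configuration :: "'a set \<Rightarrow> ('a \<Rightarrow> nat) \<Rightarrow> bool" where
  "configuration V p \<longleftrightarrow> (\<forall>v. v \<notin> V \<longrightarrow> p v = 0)"

definition config_size :: "'a set \<Rightarrow> ('a \<Rightarrow> nat) \<Rightarrow> nat" where
  "config_size V p = (\<Sum>v\<in>V. p v)"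

definition pebbling_move :: "'a set set \<Rightarrow> ('a \<Rightarrow> nat) \<Rightarrow> ('a \<Rightarrow> nat) \<Rightarrow> bool" where
  "pebbling_move E p q \<longleftrightarrow>
     (\<exists>u v. adjacent E u v \<and> 2 \<le> p u \<and> q = p(u := p u - 2, v := p v + 1))"

definition solvable :: "'a set set \<Rightarrow> ('a \<Rightarrow> nat) \<Rightarrow> 'a \<Rightarrow> bool" where
  "solvable E p r \<longleftrightarrow> (\<exists>q. (pebbling_move E)\<^sup>*\<^sup>* p q \<and> 1 \<le> q r)"

text \<open>For a connected graph some \<open>k\<close> with the stated property exists, so the least one is well
  defined.\<close>

definition pebbling_number :: "'a set \<Rightarrow> 'a set set \<Rightarrow> nat" where
  "pebbling_number V E =
     (LEAST k. \<forall>r\<in>V. \<forall>p. configuration V p \<and> config_size V p = k \<longrightarrow> solvable E p r)"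

definition class_0 :: "'a set \<Rightarrow> 'a set set \<Rightarrow> bool" where
  "class_0 V E \<longleftrightarrow> pebbling_number V E = card V"

end

theory Submission
  imports Defs
begin

text \<open>
  Let \<open>G\<close> be Class 0 with \<open>n\<close> vertices. A configuration of at least \<open>n\<close> pebbles that cannot reach
  some root is a contradiction, so every recipe for an unsolvable configuration yields an
  inequality about \<open>G\<close>. One recipe suffices: stack \<open>4 * m - 1\<close> pebbles on a vertex \<open>s\<close>, leave
  empty the ball around \<open>s\<close> that \<open>s\<close> can feed, the root \<open>r\<close> and a set \<open>K\<close> that shields \<open>r\<close>, and
  put one pebble everywhere else. If moving to the border of the ball multiplies the cost of a
  pebble by \<open>m\<close>, then only one move out of the ball is ever possible at a time; its pebble makes a
  pile of two that can wander through the single pebbles outside and can come back, but after a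
  pebble has been put on \<open>K\<close> no further pile can leave the ball
  (\<open>unsolvable_behind_barrier\<close>). Hence \<open>4 * m\<close> is at most the size of the ball plus \<open>|K| + 1\<close>
  (\<open>core_barrier_bound\<close>). Balls of radius 0, 1 and 2 give, for \<open>m = 1, 2, 4\<close>,

  \<^item> \<open>G\<close> has no cut vertex;
  \<^item> two vertices at distance at least 3 have degree sum at least 6;
  \<^item> if \<open>y\<close> has distance at least 4 from \<open>x\<close>, then \<open>deg x + deg y\<close> plus the number of vertices at
    distance 2 from \<open>x\<close> is at least 14.

  The rest is counting edges. If all degrees are at least 3, write \<open>X\<close> for the sum of \<open>deg v - 3\<close>;
  the claim says \<open>n \<le> 3 * X + 22\<close>. If the neighbours of every vertex of degree 3 have total excess
  at least 2, discharging even gives \<open>n \<le> 3 * X\<close>. Otherwise there is a vertex \<open>r\<close> of degree 3 whose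
  neighbours have total excess at most 1. A cubic tree of depth 3 has \<open>1 + 3 + 6 + 12 = 22\<close>
  vertices, which is where the constant comes from, and any excess in the first two layers enlarges
  the ball of radius 3 around \<open>r\<close> by at most three times its amount. All vertices beyond this ball
  have positive excess by the third inequality.

  If some \<open>r\<close> has degree 2, with neighbours \<open>a\<close> and \<open>b\<close>, every vertex other than \<open>r\<close>, \<open>a\<close>, \<open>b\<close> contributes
  at least 4 to twice the number of edges, counting its edges to \<open>a\<close> and \<open>b\<close> twice, except for
  the vertices of degree 2 with exactly one neighbour in \<open>{a, b}\<close>, which contribute 3. If these are
  all attached to the same neighbour of \<open>r\<close>, its large degree compensates, since \<open>G\<close> remains connected
  without it. If not, then, being pairwise at distance at most 2, they are at most two or have a
  common neighbour of large degree.
\<close>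

section \<open>Neighbours and degrees\<close>

definition nbrs :: "'a set set \<Rightarrow> 'a \<Rightarrow> 'a set" where
  "nbrs E v = {w. adjacent E v w}"

abbreviation deg :: "'a set set \<Rightarrow> 'a \<Rightarrow> nat" where
  "deg E v \<equiv> card (nbrs E v)"

lemma in_nbrs_iff: "w \<in> nbrs E v \<longleftrightarrow> adjacent E v w"
  by (simp add: nbrs_def)

lemma adjacent_sym: "adjacent E u v \<longleftrightarrow> adjacent E v u"
  by (simp add: adjacent_def insert_commute)

lemma nbrs_sym: "w \<in> nbrs E v \<longleftrightarrow> v \<in> nbrs E w"
  by (simp add: in_nbrs_iff adjacent_sym)

locale conn_graph =
  fixes V :: "'a set" and E :: "'a set set"
  assumes conn: "connected_graph V E"
begin

lemma fin_V: "finite V" and V_nonempty: "V \<noteq> {}"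
  using conn by (auto simp: connected_graph_def simple_graph_def)

lemma edgeE:
  assumes "e \<in> E"
  obtains u v where "u \<in> V" "v \<in> V" "u \<noteq> v" "e = {u, v}"
  proof -
  have "\<exists>u\<in>V. \<exists>v\<in>V. u \<noteq> v \<and> e = {u, v}"
    using conn assms by (simp add: connected_graph_def simple_graph_def)
  then show ?thesis using that by blast
qed

lemma adjacentD:
  assumes "adjacent E u v"
  shows "u \<in> V" "v \<in> V" "u \<noteq> v"
proof -
  have "{u, v} \<in> E" using assms by (simp add: adjacent_def)
  then obtain x y where "x \<in> V" "y \<in> V" "x \<noteq> y" "{u, v} = {x, y}" by (rule edgeE)
  then show "u \<in> V" "v \<in> V" "u \<noteq> v" by (auto simp: doubleton_eq_iff)
qed

lemma fin_E: "finite E"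
proof (rule finite_subset)
  show "E \<subseteq> Pow V" by (blast elim: edgeE)
  show "finite (Pow V)" using fin_V by simp
qed

lemma nbrs_subset: "nbrs E v \<subseteq> V"
  using adjacentD(2) by (auto simp: in_nbrs_iff)

lemma fin_nbrs: "finite (nbrs E v)"
  using nbrs_subset fin_V by (rule finite_subset)

lemma not_self_nbr: "v \<notin> nbrs E v"
  using adjacentD(3) by (auto simp: in_nbrs_iff)

lemma deg_eq_incident: "deg E v = card {e \<in> E. v \<in> e}"
proof -
  have "bij_betw (\<lambda>w. {v, w}) (nbrs E v) {e \<in> E. v \<in> e}"
  proof (rule bij_betw_imageI)
    show "inj_on (\<lambda>w. {v, w}) (nbrs E v)"
      by (auto simp: inj_on_def doubleton_eq_iff)
    show "(\<lambda>w. {v, w}) ` nbrs E v = {e \<in> E. v \<in> e}"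
    proof
      show "{e \<in> E. v \<in> e} \<subseteq> (\<lambda>w. {v, w}) ` nbrs E v"
      proof
        fix e assume "e \<in> {e \<in> E. v \<in> e}"
        then have e: "e \<in> E" "v \<in> e" by auto
        from e(1) obtain x y where "e = {x, y}" by (rule edgeE)
        with e have "e = {v, if v = x then y else x}" by auto
        with e(1) show "e \<in> (\<lambda>w. {v, w}) ` nbrs E v"
          by (auto simp: in_nbrs_iff adjacent_def)
      qed
    qed (auto simp: in_nbrs_iff adjacent_def)
  qed
  then show ?thesis by (rule bij_betw_same_card)
qed

lemma handshake: "(\<Sum>v\<in>V. deg E v) = 2 * card E"
proof -
  have "(\<Sum>v\<in>V. deg E v) = (\<Sum>v\<in>V. \<Sum>e\<in>E. if v \<in> e then 1 else 0)"
    by (simp add: deg_eq_incident sum.If_cases fin_E Int_def)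
  also have "\<dots> = (\<Sum>e\<in>E. \<Sum>v\<in>V. if v \<in> e then 1 else 0)"
    by (rule sum.swap)
  also have "\<dots> = (\<Sum>e\<in>E. 2)"
  proof (rule sum.cong)
    fix e assume "e \<in> E"
    then obtain x y where xy: "x \<in> V" "y \<in> V" "x \<noteq> y" "e = {x, y}" by (rule edgeE)
    then have "V \<inter> {v. v \<in> e} = {x, y}" by auto
    then show "(\<Sum>v\<in>V. if v \<in> e then 1 else 0) = (2::nat)"
      using xy by (simp add: sum.If_cases fin_V)
  qed simp
  finally show ?thesis by simp
qed

text \<open>Double counting: each \<open>w\<close> is met once from every neighbour in \<open>A\<close>.\<close>

lemma sum_over_nbrs:
  fixes f :: "'a \<Rightarrow> nat"
  assumes "A \<subseteq> V" "B \<subseteq> V"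
  shows "(\<Sum>v\<in>A. \<Sum>w\<in>nbrs E v \<inter> B. f w) = (\<Sum>w\<in>B. card (nbrs E w \<inter> A) * f w)"
proof -
  have fin: "finite A" "finite B" using assms fin_V by (auto intro: finite_subset)
  have "(\<Sum>v\<in>A. \<Sum>w\<in>nbrs E v \<inter> B. f w) = (\<Sum>v\<in>A. \<Sum>w\<in>B. if w \<in> nbrs E v then f w else 0)"
    by (rule sum.cong) (simp_all add: Int_commute[of _ B] sum.inter_restrict[OF fin(2)])
  also have "\<dots> = (\<Sum>w\<in>B. \<Sum>v\<in>A. if v \<in> nbrs E w then f w else 0)"
    by (subst sum.swap, subst nbrs_sym) (rule refl)
  also have "\<dots> = (\<Sum>w\<in>B. card (nbrs E w \<inter> A) * f w)"
    by (rule sum.cong) (simp_all add: Int_commute[of _ A] sum.inter_restrict[OF fin(1), symmetric])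
  finally show ?thesis .
qed

text \<open>Every vertex but a chosen root owns the edge to a neighbour that is closer to the root; no edge
  has two owners, since the distance drops strictly.\<close>

lemma connected_card_le: "card V \<le> card E + 1"
proof -
  obtain r where r: "r \<in> V" using V_nonempty by blast
  define d where "d v = (LEAST k. (adjacent E ^^ k) r v)" for v
  have walk: "(adjacent E ^^ d v) r v" if "v \<in> V" for v
  proof -
    have "(adjacent E)\<^sup>*\<^sup>* r v" using conn r that by (simp add: connected_graph_def)
    then have "\<exists>k. (adjacent E ^^ k) r v" by (simp add: rtranclp_power)
    then show ?thesis unfolding d_def by (rule LeastI_ex)
  qed
  have "\<exists>w. adjacent E w v \<and> d w < d v" if v: "v \<in> V - {r}" for v
  proof -
    have w: "(adjacent E ^^ d v) r v" using walk v by blast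
    have "d v \<noteq> 0"
    proof
      assume "d v = 0"
      with w v show False by simp
    qed
    then obtain k where k: "d v = Suc k" using not0_implies_Suc by blast
    with w obtain u where u: "(adjacent E ^^ k) r u" "adjacent E u v" by auto
    have "d u \<le> k" unfolding d_def by (rule Least_le) (rule u(1))
    with u(2) k show ?thesis by auto
  qed
  then obtain par where par: "\<And>v. v \<in> V - {r} \<Longrightarrow> adjacent E (par v) v \<and> d (par v) < d v"
    by metis
  have "inj_on (\<lambda>v. {par v, v}) (V - {r})"
  proof (rule inj_onI)
    fix v w assume *: "v \<in> V - {r}" "w \<in> V - {r}" "{par v, v} = {par w, w}"
    show "v = w"
    proof (rule ccontr)
      assume "v \<noteq> w"
      with *(3) have vw: "par v = w" "par w = v" by (auto simp: doubleton_eq_iff)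
      have "d w < d v" "d v < d w" using par[OF *(1)] par[OF *(2)] unfolding vw by blast+
      then show False by simp
    qed
  qed
  moreover have "(\<lambda>v. {par v, v}) ` (V - {r}) \<subseteq> E"
    using par by (auto simp: adjacent_def)
  ultimately have "card (V - {r}) \<le> card E" using fin_E by (rule card_inj_on_le)
  then show ?thesis using r fin_V by (simp add: card_Diff_singleton)
qed

section \<open>Existence of the pebbling number\<close>

lemma moves_along_edge:
  assumes "adjacent E u w" "2 * k \<le> p u"
  shows "(pebbling_move E)\<^sup>*\<^sup>* p (p(u := p u - 2 * k, w := p w + k))"
  using assms(2)
proof (induction k)
  case 0
  then show ?case by simp
next
  case (Suc k)
  have ne: "u \<noteq> w" using adjacentD(3) assms(1) by blast
  let ?q = "p(u := p u - 2 * k, w := p w + k)"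
  have "pebbling_move E ?q (?q(u := ?q u - 2, w := ?q w + 1))"
    unfolding pebbling_move_def using assms(1) Suc.prems ne by (intro exI[of _ u] exI[of _ w]) auto
  moreover have "?q(u := ?q u - 2, w := ?q w + 1) = p(u := p u - 2 * Suc k, w := p w + Suc k)"
    using ne by (auto simp: fun_eq_iff)
  ultimately show ?case using Suc by (metis Suc_leD mult_le_mono2 le_trans order_refl le_SucI rtranclp.rtrancl_into_rtrancl)
qed

lemma solvable_of_stack:
  assumes "(adjacent E ^^ d) u r" "2 ^ d \<le> p u"
  shows "solvable E p r"
  using assms
proof (induction d arbitrary: u p)
  case 0
  then show ?case by (auto simp: solvable_def)
next
  case (Suc d)
  obtain w where w: "adjacent E u w" "(adjacent E ^^ d) w r"
    using Suc.prems(1) by (metis relpowp_Suc_E2)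
  let ?q = "p(u := p u - 2 * 2 ^ d, w := p w + 2 ^ d)"
  have 1: "(pebbling_move E)\<^sup>*\<^sup>* p ?q" using Suc.prems(2) by (intro moves_along_edge w(1)) simp
  have "solvable E ?q r" by (rule Suc.IH[OF w(2)]) simp
  then obtain q where "(pebbling_move E)\<^sup>*\<^sup>* ?q q" "1 \<le> q r" by (auto simp: solvable_def)
  with 1 show ?case unfolding solvable_def by (meson rtranclp_trans)
qed

text \<open>The pebbling number is a least element, which says something only because some size solves
  everything: with \<open>card V * M\<close> pebbles, some vertex carries \<open>M\<close>, enough to send one pebble along
  any shortest path.\<close>

lemma solvable_of_pebbling_number:
  assumes "r \<in> V" "configuration V p" "config_size V p = pebbling_number V E"
  shows "solvable E p r"
proof -
  \<comment> \<open>A sum instead of a maximum, so that no finiteness and nonemptiness of the range has to be shown.\<close>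
  define M where "M = (\<Sum>u\<in>V. \<Sum>v\<in>V. (2::nat) ^ graph_dist E u v)"
  have big: "2 ^ graph_dist E u v \<le> M" if "u \<in> V" "v \<in> V" for u v
  proof -
    have "2 ^ graph_dist E u v \<le> (\<Sum>v\<in>V. (2::nat) ^ graph_dist E u v)"
      using that fin_V by (intro member_le_sum) auto
    also have "\<dots> \<le> M" unfolding M_def
      using that fin_V by (intro member_le_sum[where f = "\<lambda>u. \<Sum>v\<in>V. (2::nat) ^ graph_dist E u v"]) auto
    finally show ?thesis .
  qed
  have "solvable E q v" if v: "v \<in> V" and q: "config_size V q = card V * M" for q v
  proof -
    have "\<exists>u\<in>V. M \<le> q u"
    proof (rule ccontr)
      assume "\<not> (\<exists>u\<in>V. M \<le> q u)"
      then have "(\<Sum>u\<in>V. q u) < (\<Sum>u\<in>V. M)"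
        using fin_V V_nonempty by (intro sum_strict_mono) auto
      with q show False by (simp add: config_size_def)
    qed
    then obtain u where u: "u \<in> V" "M \<le> q u" by blast
    have "(adjacent E)\<^sup>*\<^sup>* u v" using conn u v by (simp add: connected_graph_def)
    then have "\<exists>k. (adjacent E ^^ k) u v" by (simp add: rtranclp_power)
    then have "(adjacent E ^^ graph_dist E u v) u v" unfolding graph_dist_def by (rule LeastI_ex)
    then show ?thesis using big[OF u(1) v] u(2) by (intro solvable_of_stack) auto
  qed
  then have "\<exists>k. \<forall>r\<in>V. \<forall>p. configuration V p \<and> config_size V p = k \<longrightarrow> solvable E p r"
    by blast
  then have "\<forall>r\<in>V. \<forall>p. configuration V p \<and> config_size V p = pebbling_number V E \<longrightarrow> solvable E p r"
    unfolding pebbling_number_def by (rule LeastI_ex)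
  with assms show ?thesis by blast
qed

section \<open>Configurations that never reach the root\<close>

lemma weight_after_move:
  fixes \<omega> :: "'a \<Rightarrow> nat"
  assumes "adjacent E x y" "2 \<le> p x"
  shows "(\<Sum>v\<in>V. \<omega> v * (p(x := p x - 2, y := p y + 1)) v) + 2 * \<omega> x = (\<Sum>v\<in>V. \<omega> v * p v) + \<omega> y"
proof -
  let ?q = "p(x := p x - 2, y := p y + 1)"
  have xy: "x \<in> V" "y \<in> V" "x \<noteq> y" using adjacentD assms(1) by blast+
  have split: "(\<Sum>v\<in>V. \<omega> v * f v) = \<omega> x * f x + (\<omega> y * f y + (\<Sum>v\<in>V - {x} - {y}. \<omega> v * f v))" for f
    using fin_V xy by (simp add: sum.remove[of V x] sum.remove[of "V - {x}" y])
  have rest: "(\<Sum>v\<in>V - {x} - {y}. \<omega> v * ?q v) = (\<Sum>v\<in>V - {x} - {y}. \<omega> v * p v)"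
    by (intro sum.cong) auto
  have "\<omega> x * ?q x + 2 * \<omega> x = \<omega> x * p x"
    using assms(2) xy by (simp add: algebra_simps flip: add_mult_distrib2)
  moreover have "\<omega> y * ?q y = \<omega> y * p y + \<omega> y" by simp
  ultimately show ?thesis unfolding split[of ?q] split[of p] rest by linarith
qed

text \<open>The number \<open>\<omega> v\<close> is the price of a pebble on \<open>v\<close> counted in pebbles at the source of the core
  \<open>{v. \<omega> v > 0}\<close>; by \<open>core\<close>, moves inside the core never raise the total price. A move out of the core
  costs at least \<open>2 * m\<close> by \<open>exit\<close>, a move into it earns at most \<open>2 * m\<close> by \<open>enter\<close>. With less than
  \<open>4 * m\<close> to spend, one pebble can leave, after which less than \<open>2 * m\<close> remains and nothing
  else can leave until that pebble's pile has returned. The set \<open>R\<close> is the side of the root, which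
  can be entered only through \<open>K\<close>; a lone pebble on \<open>K\<close> is stuck there.\<close>

lemma unsolvable_behind_barrier:
  fixes \<omega> :: "'a \<Rightarrow> nat" and m :: nat
  assumes core: "\<And>x y. adjacent E x y \<Longrightarrow> \<omega> x > 0 \<Longrightarrow> \<omega> y \<le> 2 * \<omega> x"
    and exit: "\<And>x y. adjacent E x y \<Longrightarrow> \<omega> x > 0 \<Longrightarrow> \<omega> y = 0 \<Longrightarrow> m \<le> \<omega> x"
    and enter: "\<And>x y. adjacent E x y \<Longrightarrow> \<omega> x = 0 \<Longrightarrow> \<omega> y \<le> 2 * m"
    and barrier: "\<And>x y. adjacent E x y \<Longrightarrow> x \<notin> R \<Longrightarrow> y \<in> R \<Longrightarrow> x \<in> K"
    and outside: "\<And>x. x \<in> K \<union> R \<Longrightarrow> \<omega> x = 0"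
    and root: "r \<in> R" "p r = 0"
    and light: "(\<Sum>v\<in>V. \<omega> v * p v) < 4 * m"
    and flat: "\<And>v. \<omega> v = 0 \<Longrightarrow> p v \<le> 1"
    and empty: "\<And>v. v \<in> K \<Longrightarrow> p v = 0"
  shows "\<not> solvable E p r"
proof -
  define W where "W q = (\<Sum>v\<in>V. \<omega> v * q v)" for q :: "'a \<Rightarrow> nat"
  define full where "full q \<longleftrightarrow> W q < 4 * m \<and> (\<forall>v. \<omega> v = 0 \<longrightarrow> q v \<le> 1) \<and> (\<forall>v\<in>K. q v = 0)" for q
  define travelling where "travelling q \<longleftrightarrow> W q < 2 * m \<and> (\<forall>v\<in>K. q v = 0) \<and>
     (\<exists>z. z \<notin> K \<union> R \<and> \<omega> z = 0 \<and> q z \<le> 2 \<and> (\<forall>v. v \<noteq> z \<longrightarrow> \<omega> v = 0 \<longrightarrow> q v \<le> 1))" for q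
  define dead where "dead q \<longleftrightarrow> W q < 2 * m \<and> (\<forall>v. \<omega> v = 0 \<longrightarrow> q v \<le> 1)" for q
  \<comment> \<open>The invariant is the disjunction of these three phases: nothing is outside, one pile of two is
    under way at \<open>z\<close>, or the pile has been used up on \<open>K\<close>.\<close>
  have heavy: "2 * \<omega> x \<le> W q" if "2 \<le> q x" "x \<in> V" for q x
  proof -
    have "2 * \<omega> x \<le> \<omega> x * q x" using that(1) by simp
    also have "\<dots> \<le> W q" unfolding W_def
      using that fin_V by (intro member_le_sum[where f = "\<lambda>v. \<omega> v * q v"]) auto
    finally show ?thesis .
  qed
  have move_inv: "q' r = 0 \<and> (full q' \<or> travelling q' \<or> dead q')"
    if inv: "q r = 0" "full q \<or> travelling q \<or> dead q" and move: "pebbling_move E q q'" for q q'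
  proof -
    obtain x y where xy: "adjacent E x y" "2 \<le> q x" and q': "q' = q(x := q x - 2, y := q y + 1)"
      using move by (auto simp: pebbling_move_def)
    have V: "x \<in> V" "y \<in> V" "x \<noteq> y" using adjacentD xy(1) by blast+
    have W': "W q' + 2 * \<omega> x = W q + \<omega> y"
      unfolding W_def q' by (rule weight_after_move[where p = q, OF xy])
    have hx: "2 * \<omega> x \<le> W q" by (rule heavy[where q = q, OF xy(2) V(1)])
    have vals: "q' x = q x - 2" "q' y = q y + 1" "\<And>v. v \<noteq> x \<Longrightarrow> v \<noteq> y \<Longrightarrow> q' v = q v"
      using V by (auto simp: q')
    have le: "q' v \<le> q v" if "v \<noteq> y" for v using that by (auto simp: q')
    have "y \<notin> R \<and> (full q' \<or> travelling q' \<or> dead q')"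
    proof (cases "\<omega> x = 0")
      case False
      then have "x \<notin> K" "x \<notin> R" using outside[of x] by auto
      then have y: "y \<notin> R" using barrier[OF xy(1)] by auto
      show ?thesis
      proof (cases "\<omega> y = 0")
        case True
        have ex: "m \<le> \<omega> x" using exit[OF xy(1)] False True by simp
        from inv(2) have full: "full q" using hx ex by (auto simp: travelling_def dead_def)
        have light': "W q' < 2 * m" using W' full ex True by (simp add: full_def)
        have fl: "q' v \<le> 1" if "v \<noteq> y" "\<omega> v = 0" for v
        proof -
          have "q v \<le> 1" using full that(2) by (simp add: full_def)
          then show ?thesis using le[OF that(1)] by simp
        qed
        show ?thesis
        proof (cases "y \<in> K")
          case True
          then have "q' y = 1" using full vals(2) by (simp add: full_def)
          have "\<forall>v. \<omega> v = 0 \<longrightarrow> q' v \<le> 1"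
            using fl \<open>q' y = 1\<close> by (metis order_refl)
          then have "dead q'" unfolding dead_def using light' by simp
          with y show ?thesis by simp
        next
          case notK: False
          have "\<forall>v\<in>K. q' v = 0"
          proof
            fix v assume v: "v \<in> K"
            then have "v \<noteq> y" "q v = 0" using notK full by (auto simp: full_def)
            then show "q' v = 0" using le[of v] by simp
          qed
          moreover have "q' y \<le> 2" using full True vals(2) by (simp add: full_def)
          ultimately have "travelling q'" unfolding travelling_def
            using light' fl notK y True by (intro conjI exI[of _ y]) auto
          with y show ?thesis by simp
        qed
      next
        case ypos: False
        have wl: "W q' \<le> W q" using W' core[OF xy(1)] False by simp
        have le': "q' v \<le> q v" if "\<omega> v = 0" for v using le[of v] that ypos by fastforce
        have K': "q' v \<le> q v" if "v \<in> K" for v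
        proof -
          have "\<omega> v = 0" by (rule outside) (simp add: that)
          then show ?thesis by (rule le')
        qed
        from inv(2) have "full q' \<or> travelling q' \<or> dead q'"
        proof (elim disjE)
          assume "full q"
          then have f: "W q < 4 * m" "\<And>v. \<omega> v = 0 \<Longrightarrow> q v \<le> 1" "\<And>v. v \<in> K \<Longrightarrow> q v = 0"
            by (auto simp: full_def)
          have "W q' < 4 * m" using wl f(1) by simp
          moreover have "q' v \<le> 1" if "\<omega> v = 0" for v using le'[OF that] f(2)[OF that] by simp
          moreover have "q' v = 0" if "v \<in> K" for v using K'[OF that] f(3)[OF that] by simp
          ultimately have "full q'" by (simp add: full_def)
          then show ?thesis by simp
        next
          assume "travelling q"
          then obtain z where z: "W q < 2 * m" "\<forall>v\<in>K. q v = 0" "z \<notin> K \<union> R" "\<omega> z = 0" "q z \<le> 2"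
            "\<forall>v. v \<noteq> z \<longrightarrow> \<omega> v = 0 \<longrightarrow> q v \<le> 1" by (auto simp: travelling_def)
          have "W q' < 2 * m" using wl z(1) by simp
          moreover have "\<forall>v\<in>K. q' v = 0"
          proof
            fix v assume v: "v \<in> K"
            show "q' v = 0" using K'[OF v] z(2) v by simp
          qed
          moreover have "q' z \<le> 2" using le'[OF z(4)] z(5) by simp
          moreover have "q' v \<le> 1" if "v \<noteq> z" "\<omega> v = 0" for v
            using le'[OF that(2)] z(6)[rule_format, OF that] by simp
          ultimately have "travelling q'" unfolding travelling_def
            using z(3,4) by (intro conjI exI[of _ z]) auto
          then show ?thesis by simp
        next
          assume "dead q"
          then have f: "W q < 2 * m" "\<And>v. \<omega> v = 0 \<Longrightarrow> q v \<le> 1" by (auto simp: dead_def)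
          have "W q' < 2 * m" using wl f(1) by simp
          moreover have "q' v \<le> 1" if "\<omega> v = 0" for v using le'[OF that] f(2)[OF that] by simp
          ultimately have "dead q'" by (simp add: dead_def)
          then show ?thesis by simp
        qed
        with y show ?thesis by simp
      qed
    next
      case x0: True
      then have "\<not> (\<forall>v. \<omega> v = 0 \<longrightarrow> q v \<le> 1)" using xy(2) by (auto intro!: exI[of _ x])
      then have "travelling q" using inv(2) unfolding full_def dead_def by blast
      then obtain z where z: "W q < 2 * m" "\<forall>v\<in>K. q v = 0" "z \<notin> K \<union> R" "\<omega> z = 0" "q z \<le> 2"
        "\<forall>v. v \<noteq> z \<longrightarrow> \<omega> v = 0 \<longrightarrow> q v \<le> 1" by (auto simp: travelling_def)
      have xz: "x = z" using z(6) x0 xy(2) by force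
      have y: "y \<notin> R" using barrier[OF xy(1)] z(3) unfolding xz by auto
      have x': "q' x = 0" using z(5) xz vals(1) by simp
      have fl: "q' v \<le> 1" if "v \<noteq> y" "\<omega> v = 0" for v
        using z(6) x' xz vals(3) that by (cases "v = x") auto
      show ?thesis
      proof (cases "\<omega> y = 0")
        case False
        have "W q' < 4 * m" using W' x0 z(1) enter[OF xy(1) x0] by simp
        moreover have "\<forall>v\<in>K. q' v = 0"
        proof
          fix v assume v: "v \<in> K"
          then have "v \<noteq> y" "q v = 0" using False outside z(2) by auto
          then show "q' v = 0" using le[of v] by simp
        qed
        moreover have "\<forall>v. \<omega> v = 0 \<longrightarrow> q' v \<le> 1" using fl False by force
        ultimately have "full q'" unfolding full_def by simp
        with y show ?thesis by simp
      next
        case y0: True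
        have w: "W q' < 2 * m" using W' x0 y0 z(1) by simp
        show ?thesis
        proof (cases "y \<in> K")
          case True
          then have "q' y = 1" using z(2) vals(2) by simp
          have "\<forall>v. \<omega> v = 0 \<longrightarrow> q' v \<le> 1"
            using fl \<open>q' y = 1\<close> by (metis order_refl)
          then have "dead q'" unfolding dead_def using w by simp
          with y show ?thesis by simp
        next
          case notK: False
          have "\<forall>v\<in>K. q' v = 0"
          proof
            fix v assume v: "v \<in> K"
            then have "v \<noteq> y" "q v = 0" using notK z(2) by auto
            then show "q' v = 0" using le[of v] by simp
          qed
          moreover have "q' y \<le> 2" using z(6) y0 xz V(3) vals(2) by auto
          ultimately have "travelling q'" unfolding travelling_def
            using w fl notK y y0 by (intro conjI exI[of _ y]) auto
          with y show ?thesis by simp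
        qed
      qed
    qed
    then have y: "y \<noteq> r" and res: "full q' \<or> travelling q' \<or> dead q'" using root(1) by auto
    from y have "q' r = 0" using inv(1) le[of r] by simp
    with res show ?thesis by simp
  qed
  have start: "p r = 0 \<and> (full p \<or> travelling p \<or> dead p)"
    using root(2) light flat empty by (auto simp: full_def W_def)
  have "q r = 0 \<and> (full q \<or> travelling q \<or> dead q)" if "(pebbling_move E)\<^sup>*\<^sup>* p q" for q
    using that
  proof (induction rule: rtranclp_induct)
    case base
    show ?case by (rule start)
  next
    case (step y z)
    then show ?case using move_inv[of y z] by simp
  qed
  then have "q r = 0" if "(pebbling_move E)\<^sup>*\<^sup>* p q" for q using that by blast
  then show ?thesis by (force simp: solvable_def)
qed

end

lemma exists_smaller_config:
  fixes f :: "'a \<Rightarrow> nat"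
  assumes "finite A" "k \<le> sum f A"
  shows "\<exists>g. (\<forall>v. g v \<le> f v) \<and> sum g A = k"
  using assms
proof (induction A arbitrary: k rule: finite_induct)
  case empty
  then show ?case by auto
next
  case (insert a A)
  have "k - min k (f a) \<le> sum f A" using insert by simp
  then obtain g where g: "\<forall>v. g v \<le> f v" "sum g A = k - min k (f a)" using insert.IH by blast
  have "sum (g(a := min k (f a))) A = sum g A" using insert.hyps by (intro sum.cong) auto
  then have "sum (g(a := min k (f a))) (insert a A) = k"
    using insert.hyps g(2) by simp
  then show ?case using g(1) by (intro exI[of _ "g(a := min k (f a))"]) auto
qed

section \<open>What Class 0 forces\<close>

locale class_0_graph = conn_graph +
  assumes class0: "class_0 V E"
begin

text \<open>The inequality that the recipe yields. The stack replaces one pebble by \<open>4 * m - 1\<close>, and the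
  vertices of the core, of \<open>K\<close> and the root are empty otherwise; the total must stay below the number of
  vertices.\<close>

lemma core_barrier_bound:
  fixes \<omega> :: "'a \<Rightarrow> nat" and m :: nat
  assumes core: "\<And>x y. adjacent E x y \<Longrightarrow> \<omega> x > 0 \<Longrightarrow> \<omega> y \<le> 2 * \<omega> x"
    and exit: "\<And>x y. adjacent E x y \<Longrightarrow> \<omega> x > 0 \<Longrightarrow> \<omega> y = 0 \<Longrightarrow> m \<le> \<omega> x"
    and enter: "\<And>x y. adjacent E x y \<Longrightarrow> \<omega> x = 0 \<Longrightarrow> \<omega> y \<le> 2 * m"
    and barrier: "\<And>x y. adjacent E x y \<Longrightarrow> x \<notin> R \<Longrightarrow> y \<in> R \<Longrightarrow> x \<in> K"
    and outside: "\<And>x. x \<in> K \<union> R \<Longrightarrow> \<omega> x = 0"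
    and source: "s \<in> V" "\<omega> s = 1"
    and root: "r \<in> R" "r \<in> V"
    and m: "0 < m"
    and fin: "finite Q" "finite K" and Q: "\<And>v. \<omega> v > 0 \<Longrightarrow> v \<in> Q"
  shows "4 * m \<le> card Q + card K + 1"
proof (rule ccontr)
  assume small: "\<not> ?thesis"
  define Z where "Z = Q \<union> K \<union> {r}"
  define p where "p v = (if v = s then 4 * m - 1 else if v \<in> Z \<or> v \<notin> V then 0 else 1)" for v
  have s: "s \<in> Z" using Q source(2) by (simp add: Z_def)
  have fZ: "finite Z" using fin by (simp add: Z_def)
  have "card Z \<le> card (Q \<union> K) + card {r}" unfolding Z_def by (rule card_Un_le)
  moreover have "card (Q \<union> K) \<le> card Q + card K" by (rule card_Un_le)
  ultimately have cZ: "card Z \<le> card Q + card K + 1" by simp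
  have "sum p V = p s + sum p (V - {s})" using fin_V source(1) by (simp add: sum.remove)
  also have "sum p (V - {s}) = sum p (V - Z)"
    using fin_V s by (intro sum.mono_neutral_right) (auto simp: p_def)
  also have "sum p (V - Z) = (\<Sum>v\<in>V - Z. 1)"
    using s by (intro sum.cong) (auto simp: p_def)
  finally have "sum p V = 4 * m - 1 + card (V - Z)" by (simp add: p_def)
  moreover have "card V - card Z \<le> card (V - Z)" using fZ by (rule diff_card_le_card_Diff)
  ultimately have "card V \<le> sum p V" using small cZ by linarith
  then obtain q where q: "\<And>v. q v \<le> p v" "sum q V = card V"
    using exists_smaller_config[OF fin_V] by metis
  \<comment> \<open>The hypotheses of the previous lemma are upper bounds, so they pass from \<open>p\<close> to a
    configuration below it that has exactly \<open>card V\<close> pebbles.\<close>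
  have rs: "r \<noteq> s" using outside root(1) source(2) by fastforce
  have "\<not> solvable E q r"
  proof (rule unsolvable_behind_barrier[where \<omega> = \<omega> and m = m and R = R and K = K])
    show "q r = 0" using q(1)[of r] rs by (simp add: p_def Z_def)
    show "q v \<le> 1" if "\<omega> v = 0" for v
      using q(1)[of v] that source(2) by (auto simp: p_def split: if_splits)
    show "q v = 0" if "v \<in> K" for v
    proof -
      have "v \<noteq> s" using outside that source(2) by fastforce
      then show ?thesis using q(1)[of v] that by (simp add: p_def Z_def)
    qed
    have "(\<Sum>v\<in>V. \<omega> v * q v) \<le> (\<Sum>v\<in>V. if v = s then 4 * m - 1 else 0)"
    proof (rule sum_mono)
      fix v
      show "\<omega> v * q v \<le> (if v = s then 4 * m - 1 else 0)"
      proof (cases "v = s")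
        case True
        then show ?thesis using q(1)[of v] source(2) by (simp add: p_def)
      next
        case False
        then have "q v = 0" if "v \<in> Q" using q(1)[of v] that False by (simp add: p_def Z_def)
        then have "\<omega> v = 0 \<or> q v = 0" using Q[of v] by fastforce
        then show ?thesis by auto
      qed
    qed
    also have "\<dots> = 4 * m - 1" using fin_V source(1) by simp
    finally show "(\<Sum>v\<in>V. \<omega> v * q v) < 4 * m" using m by simp
  qed (use assms in auto)
  moreover have "solvable E q r"
  proof (rule solvable_of_pebbling_number[OF root(2)])
    show "configuration V q" unfolding configuration_def
    proof (intro allI impI)
      fix v assume "v \<notin> V"
      then show "q v = 0" using q(1)[of v] source(1) by (auto simp: p_def split: if_splits)
    qed
    show "config_size V q = pebbling_number V E"
      using q(2) class0 by (simp add: config_size_def class_0_def)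
  qed
  ultimately show False by simp
qed

text \<open>The case \<open>m = 1\<close>: three pebbles on \<open>u\<close> and none on a cut vertex \<open>a\<close> leave the root beyond \<open>a\<close>
  without a pebble.\<close>

lemma connected_without_vertex:
  assumes a: "a \<in> V" "V - {a} \<noteq> {}"
  shows "connected_graph (V - {a}) {e \<in> E. a \<notin> e}"
proof -
  let ?E = "{e \<in> E. a \<notin> e}"
  have adj: "adjacent ?E u v \<longleftrightarrow> adjacent E u v \<and> u \<noteq> a \<and> v \<noteq> a" for u v
    by (auto simp: adjacent_def)
  have "simple_graph (V - {a}) ?E" unfolding simple_graph_def
  proof (intro conjI ballI)
    fix e assume "e \<in> ?E"
    then have e: "e \<in> E" "a \<notin> e" by auto
    obtain u v where "u \<in> V" "v \<in> V" "u \<noteq> v" "e = {u, v}" using e(1) by (rule edgeE)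
    with e(2) show "\<exists>u\<in>V - {a}. \<exists>v\<in>V - {a}. u \<noteq> v \<and> e = {u, v}" by blast
  qed (use a fin_V in auto)
  moreover have "(adjacent ?E)\<^sup>*\<^sup>* u r" if u: "u \<in> V - {a}" and r: "r \<in> V - {a}" for u r
  proof (rule ccontr)
    assume no: "\<not> (adjacent ?E)\<^sup>*\<^sup>* u r"
    define U where "U = {v. (adjacent ?E)\<^sup>*\<^sup>* u v}"
    have uU: "u \<in> U" by (simp add: U_def)
    have "4 * 1 \<le> card {u} + card {a} + 1"
    proof (rule core_barrier_bound[where \<omega> = "\<lambda>v. if v = u then 1 else 0" and s = u
          and R = "V - U - {a}" and r = r])
      fix x y assume xy: "adjacent E x y" "x \<notin> V - U - {a}" "y \<in> V - U - {a}"
      show "x \<in> {a}"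
      proof (rule ccontr)
        assume "x \<notin> {a}"
        then have "x \<in> U" "adjacent ?E x y" using xy adjacentD(1)[OF xy(1)] adj by auto
        then have "y \<in> U" unfolding U_def by (auto intro: rtranclp.rtrancl_into_rtrancl)
        with xy(3) show False by simp
      qed
    next
      show "r \<in> V - U - {a}" using no r by (auto simp: U_def)
    qed (use u r uU in \<open>auto split: if_splits\<close>)
    then show False by simp
  qed
  ultimately show ?thesis unfolding connected_graph_def by blast
qed

text \<open>Deleting \<open>a\<close> loses its \<open>deg a\<close> edges and leaves a connected graph on \<open>n - 1\<close> vertices.\<close>

lemma edges_ge_deg:
  assumes "a \<in> V" "V - {a} \<noteq> {}"
  shows "card V + deg E a \<le> card E + 2"
proof -
  interpret rest: conn_graph "V - {a}" "{e \<in> E. a \<notin> e}"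
    by standard (rule connected_without_vertex[OF assms])
  have "card E = card ({e \<in> E. a \<in> e} \<union> {e \<in> E. a \<notin> e})"
    by (rule arg_cong[where f = card]) auto
  also have "\<dots> = deg E a + card {e \<in> E. a \<notin> e}"
    unfolding deg_eq_incident using fin_E by (intro card_Un_disjoint) auto
  finally show ?thesis using rest.connected_card_le assms(1) fin_V by simp
qed

text \<open>The only neighbour of a vertex would be a cut vertex.\<close>

lemma deg_ge_2:
  assumes "v \<in> V" "3 \<le> card V"
  shows "2 \<le> deg E v"
proof (rule ccontr)
  assume small: "\<not> 2 \<le> deg E v"
  obtain b where b: "b \<in> V" "b \<noteq> v" "nbrs E v \<subseteq> {b}"
  proof (cases "nbrs E v = {}")
    case True
    have "V \<noteq> {v}" using assms(2) by auto
    then obtain b where "b \<in> V" "b \<noteq> v" using assms(1) by blast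
    then show ?thesis using True that by blast
  next
    case False
    then have "deg E v \<noteq> 0" using fin_nbrs by simp
    with small have "deg E v = 1" by linarith
    then obtain b where "nbrs E v = {b}" by (rule card_1_singletonE)
    then show ?thesis using that nbrs_subset[of v] not_self_nbr[of v] by blast
  qed
  have "card {v, b} < card V" using b(2) assms(2) by simp
  then have "V \<noteq> {v, b}" by auto
  then obtain w where w: "w \<in> V" "w \<noteq> v" "w \<noteq> b" using assms(1) b(1) by blast
  have "connected_graph (V - {b}) {e \<in> E. b \<notin> e}"
    using b assms(1) by (intro connected_without_vertex) auto
  then have "(adjacent {e \<in> E. b \<notin> e})\<^sup>*\<^sup>* v w"
    using w assms(1) b(2) by (auto simp: connected_graph_def)
  then obtain y where "adjacent {e \<in> E. b \<notin> e} v y"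
    using w(2) by (auto elim: converse_rtranclpE)
  then have "y \<in> nbrs E v" "y \<noteq> b" by (auto simp: adjacent_def in_nbrs_iff)
  with b(3) show False by blast
qed

text \<open>The case \<open>m = 2\<close>: seven pebbles on \<open>x\<close>, with the neighbourhoods of both \<open>x\<close> and the root
  \<open>y\<close> empty. The hypotheses say that the distance of \<open>x\<close> and \<open>y\<close> is at least 3.\<close>

lemma deg_sum_ge_6:
  assumes "x \<in> V" "y \<in> V" "x \<noteq> y" "y \<notin> nbrs E x" "nbrs E x \<inter> nbrs E y = {}"
  shows "6 \<le> deg E x + deg E y"
proof -
  let ?\<omega> = "\<lambda>v. if v = x then 1 else if v \<in> nbrs E x then 2 else 0 :: nat"
  have "4 * 2 \<le> card (insert x (nbrs E x)) + deg E y + 1"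
  proof (rule core_barrier_bound[where \<omega> = ?\<omega> and s = x and R = "{y}" and r = y])
    fix u v assume uv: "adjacent E u v"
    show "?\<omega> v \<le> 2 * ?\<omega> u" if "?\<omega> u > 0"
      using that uv by (auto simp: in_nbrs_iff split: if_splits)
    show "2 \<le> ?\<omega> u" if "?\<omega> u > 0" "?\<omega> v = 0"
      using that uv by (auto simp: in_nbrs_iff split: if_splits)
    show "u \<in> nbrs E y" if "v \<in> {y}"
      using uv that by (simp add: in_nbrs_iff adjacent_sym)
  next
    fix u assume "u \<in> nbrs E y \<union> {y}"
    then show "?\<omega> u = 0" using assms(3,4,5) nbrs_sym[of x E y] by auto
  qed (use assms fin_nbrs in \<open>auto split: if_splits\<close>)
  then show ?thesis using fin_nbrs not_self_nbr by simp
qed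

definition second_nbrs :: "'a \<Rightarrow> 'a set" where
  "second_nbrs x = (\<Union>w\<in>nbrs E x. nbrs E w) - insert x (nbrs E x)"

lemma second_nbrs_subset: "second_nbrs x \<subseteq> V"
  using nbrs_subset by (auto simp: second_nbrs_def)

lemma fin_second_nbrs: "finite (second_nbrs x)"
  using second_nbrs_subset fin_V by (rule finite_subset)

text \<open>The case \<open>m = 4\<close>: fifteen pebbles on \<open>x\<close> with the ball of radius 2 and the neighbourhood of the
  root \<open>y\<close> empty. The hypotheses say that the distance of \<open>x\<close> and \<open>y\<close> is at least 4.\<close>

lemma deg_ball_sum_ge_14:
  assumes "x \<in> V" "y \<in> V" "x \<noteq> y" "y \<notin> nbrs E x" "y \<notin> second_nbrs x"
    and "nbrs E y \<inter> second_nbrs x = {}"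
  shows "14 \<le> deg E x + card (second_nbrs x) + deg E y"
proof -
  let ?\<omega> = "\<lambda>v. if v = x then 1 else if v \<in> nbrs E x then 2 else if v \<in> second_nbrs x then 4 else 0 :: nat"
  have second: "v = x \<or> v \<in> nbrs E x \<or> v \<in> second_nbrs x" if "u \<in> nbrs E x" "adjacent E u v" for u v
    using that by (auto simp: second_nbrs_def in_nbrs_iff)
  have dis: "nbrs E x \<inter> nbrs E y = {}"
    using second[of _ y] assms(3-5) by (auto simp: in_nbrs_iff adjacent_sym)
  have xy: "x \<notin> nbrs E y" using assms(4) nbrs_sym by metis
  have "4 * 4 \<le> card (insert x (nbrs E x) \<union> second_nbrs x) + deg E y + 1"
  proof (rule core_barrier_bound[where \<omega> = ?\<omega> and s = x and R = "{y}" and r = y])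
    fix u v assume uv: "adjacent E u v"
    show "?\<omega> v \<le> 2 * ?\<omega> u" if "?\<omega> u > 0"
      using that uv by (auto simp: in_nbrs_iff split: if_splits)
    show "4 \<le> ?\<omega> u" if "?\<omega> u > 0" "?\<omega> v = 0"
      using that uv second[of u v] by (auto simp: in_nbrs_iff split: if_splits)
    show "u \<in> nbrs E y" if "v \<in> {y}"
      using uv that by (simp add: in_nbrs_iff adjacent_sym)
  next
    fix u assume "u \<in> nbrs E y \<union> {y}"
    then show "?\<omega> u = 0" using assms dis xy by auto
  qed (use assms fin_nbrs fin_second_nbrs in \<open>auto split: if_splits\<close>)
  moreover have "card (insert x (nbrs E x) \<union> second_nbrs x) \<le> card (insert x (nbrs E x)) + card (second_nbrs x)"
    by (rule card_Un_le)
  ultimately show ?thesis using fin_nbrs not_self_nbr by simp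
qed

section \<open>Minimum degree three\<close>

abbreviation excess :: "'a \<Rightarrow> nat" where
  "excess v \<equiv> deg E v - 3"

text \<open>Every vertex \<open>w\<close> sends \<open>min 2 (excess w)\<close> to each neighbour, in units of one sixth of excess. Each
  vertex of degree 3 receives at least 2 units. A vertex of degree 4 has 6 units and sends 4, and one
  of degree \<open>d \<ge> 5\<close> has \<open>6 * (d - 3)\<close> units and sends \<open>2 * d\<close>, so at least 2 are left in
  either case. Thus every vertex ends with one third.\<close>

lemma discharging:
  assumes deg3: "\<And>v. v \<in> V \<Longrightarrow> 3 \<le> deg E v"
    and rich: "\<And>v. v \<in> V \<Longrightarrow> deg E v = 3 \<Longrightarrow> 2 \<le> (\<Sum>w\<in>nbrs E v. excess w)"
  shows "card V \<le> 3 * (\<Sum>v\<in>V. excess v)"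
proof -
  define \<mu> where "\<mu> w = min 2 (excess w)" for w
  have get: "(if deg E v = 3 then 2 else 0) \<le> (\<Sum>w\<in>nbrs E v. \<mu> w)" if v: "v \<in> V" for v
  proof (cases "deg E v = 3 \<and> (\<forall>w\<in>nbrs E v. excess w \<le> 2)")
    case True
    then have "(\<Sum>w\<in>nbrs E v. \<mu> w) = (\<Sum>w\<in>nbrs E v. excess w)"
      by (intro sum.cong) (auto simp: \<mu>_def)
    then show ?thesis using rich[OF v] by simp
  next
    case False
    show ?thesis
    proof (cases "deg E v = 3")
      case True
      with False obtain w where w: "w \<in> nbrs E v" "2 \<le> excess w" by auto
      have "\<mu> w \<le> (\<Sum>w\<in>nbrs E v. \<mu> w)" using w(1) fin_nbrs by (intro member_le_sum) auto
      then show ?thesis using w(2) by (simp add: \<mu>_def)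
    qed simp
  qed
  have give: "deg E w * \<mu> w + (if deg E w = 3 then 0 else 2) \<le> 6 * excess w" if w: "w \<in> V" for w
  proof -
    consider "deg E w = 3" | "deg E w = 4" | "5 \<le> deg E w" using deg3[OF w] by linarith
    then show ?thesis by cases (auto simp: \<mu>_def)
  qed
  have "2 * card V = (\<Sum>v\<in>V. (if deg E v = 3 then 2 else 0) + (if deg E v = 3 then 0 else 2))"
    by (subst sum.cong[OF refl, where h = "\<lambda>_. 2"]) auto
  also have "\<dots> \<le> (\<Sum>v\<in>V. (\<Sum>w\<in>nbrs E v \<inter> V. \<mu> w) + (if deg E v = 3 then 0 else 2))"
    using get nbrs_subset by (intro sum_mono add_mono) (auto simp: Int_absorb2)
  also have "\<dots> = (\<Sum>w\<in>V. card (nbrs E w \<inter> V) * \<mu> w + (if deg E w = 3 then 0 else 2))"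
    by (simp only: sum.distrib sum_over_nbrs[OF order_refl order_refl])
  also have "\<dots> \<le> (\<Sum>w\<in>V. 6 * excess w)"
    using give nbrs_subset by (intro sum_mono) (simp add: Int_absorb2)
  finally show ?thesis by (simp add: sum_distrib_left[symmetric])
qed

text \<open>Let \<open>e1\<close> and \<open>e2\<close> be the total excess at distance 1 and 2 from \<open>r\<close>. The layers around \<open>r\<close> have
  sizes \<open>3\<close>, at most \<open>6 + e1\<close>, and at most \<open>12 + 2 * e1 + e2\<close>, so the ball of radius 3 has at most
  \<open>22 + 3 * e1 + e2\<close> vertices. As \<open>e1 \<le> 1\<close>, the second layer has at most 7 vertices, and then each
  vertex beyond the ball must have degree at least \<open>14 - 3 - 7 = 4\<close>: it pays for itself.\<close>

lemma card_le_from_poor_vertex: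
  assumes deg3: "\<And>v. v \<in> V \<Longrightarrow> 3 \<le> deg E v"
    and r: "r \<in> V" "deg E r = 3" and poor: "(\<Sum>w\<in>nbrs E r. excess w) \<le> 1"
  shows "card V \<le> 3 * (\<Sum>v\<in>V. excess v) + 22"
proof -
  let ?D1 = "nbrs E r" and ?D2 = "second_nbrs r"
  define D3 where "D3 = (\<Union>w\<in>?D2. nbrs E w) - (insert r ?D1 \<union> ?D2)"
  define F where "F = V - (insert r ?D1 \<union> ?D2 \<union> D3)"
  have fin: "finite ?D1" "finite ?D2" "finite F" "finite D3"
    using fin_nbrs fin_second_nbrs fin_V by (auto simp: F_def D3_def)
  have "card ?D2 \<le> card (\<Union>w\<in>?D1. nbrs E w - {r})"
    using fin_nbrs by (intro card_mono) (auto simp: second_nbrs_def)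
  also have "\<dots> \<le> (\<Sum>w\<in>?D1. card (nbrs E w - {r}))" by (rule card_UN_le[OF fin(1)])
  also have "\<dots> = (\<Sum>w\<in>?D1. excess w + 2)"
  proof (rule sum.cong)
    fix w assume w: "w \<in> ?D1"
    then have "r \<in> nbrs E w" "w \<in> V" using nbrs_sym[of w E r] nbrs_subset[of r] by auto
    then show "card (nbrs E w - {r}) = excess w + 2"
      using fin_nbrs deg3[of w] by (simp add: card_Diff_singleton)
  qed simp
  also have "\<dots> = (\<Sum>w\<in>?D1. excess w) + 6" unfolding sum.distrib by (simp add: r(2))
  finally have D2: "card ?D2 \<le> (\<Sum>w\<in>?D1. excess w) + 6" .
  \<comment> \<open>A vertex of the second layer has a neighbour in the first, so at most \<open>deg - 1\<close> in the third.\<close>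
  have "card D3 \<le> card (\<Union>w\<in>?D2. nbrs E w - ?D1)"
    using fin_nbrs fin by (intro card_mono) (auto simp: D3_def)
  also have "\<dots> \<le> (\<Sum>w\<in>?D2. card (nbrs E w - ?D1))" by (rule card_UN_le[OF fin(2)])
  also have "\<dots> \<le> (\<Sum>w\<in>?D2. excess w + 2)"
  proof (rule sum_mono)
    fix w assume w: "w \<in> ?D2"
    then obtain u where u: "u \<in> ?D1" "w \<in> nbrs E u" by (auto simp: second_nbrs_def)
    then have uw: "u \<in> nbrs E w" using nbrs_sym by metis
    have "card (nbrs E w - ?D1) \<le> card (nbrs E w - {u})"
      using u(1) fin_nbrs by (intro card_mono) auto
    also have "\<dots> = deg E w - 1" using uw by (simp add: card_Diff_singleton)
    finally show "card (nbrs E w - ?D1) \<le> excess w + 2" by simp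
  qed
  also have "\<dots> = (\<Sum>w\<in>?D2. excess w) + 2 * card ?D2" unfolding sum.distrib by simp
  finally have D3: "card D3 \<le> (\<Sum>w\<in>?D2. excess w) + 2 * card ?D2" .
  have far: "1 \<le> excess y" if y: "y \<in> F" for y
  proof -
    have y': "y \<in> V" "r \<noteq> y" "y \<notin> ?D1" "y \<notin> ?D2" "y \<notin> D3" using y by (auto simp: F_def)
    have "nbrs E y \<inter> ?D2 = {}"
      using y'(2-5) nbrs_sym[of y E] by (auto simp: D3_def)
    then have "14 \<le> deg E r + card ?D2 + deg E y"
      using r(1) y' by (intro deg_ball_sum_ge_14) auto
    then show ?thesis using D2 poor r(2) by linarith
  qed
  have "card F \<le> (\<Sum>y\<in>F. excess y)" using sum_mono[of F "\<lambda>_. 1" excess] far by simp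
  moreover have "(\<Sum>w\<in>?D1. excess w) + (\<Sum>w\<in>?D2. excess w) + (\<Sum>w\<in>F. excess w) \<le> (\<Sum>v\<in>V. excess v)"
  proof -
    have "(\<Sum>w\<in>?D1. excess w) + (\<Sum>w\<in>?D2. excess w) + (\<Sum>w\<in>F. excess w) = (\<Sum>w\<in>?D1 \<union> ?D2 \<union> F. excess w)"
      using fin by (subst sum.union_disjoint, simp, simp, force simp: F_def)
        (subst sum.union_disjoint, auto simp: second_nbrs_def)
    also have "\<dots> \<le> (\<Sum>v\<in>V. excess v)"
      using fin_V nbrs_subset second_nbrs_subset by (intro sum_mono2) (auto simp: F_def)
    finally show ?thesis .
  qed
  moreover have "card V \<le> 1 + 3 + card ?D2 + card D3 + card F"
  proof -
    have "card V \<le> card (insert r ?D1 \<union> ?D2 \<union> D3 \<union> F)"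
      using fin by (intro card_mono) (auto simp: F_def)
    also have "\<dots> \<le> card (insert r ?D1) + card ?D2 + card D3 + card F"
      by (meson card_Un_le add_le_mono1 order_trans)
    finally show ?thesis using fin r(2) not_self_nbr by simp
  qed
  ultimately show ?thesis using D2 D3 by linarith
qed

lemma edges_min_deg_3:
  assumes deg3: "\<And>v. v \<in> V \<Longrightarrow> 3 \<le> deg E v"
  shows "5 * card V \<le> 3 * card E + 11"
proof -
  have "card V \<le> 3 * (\<Sum>v\<in>V. excess v) + 22"
  proof (cases "\<exists>r\<in>V. deg E r = 3 \<and> (\<Sum>w\<in>nbrs E r. excess w) \<le> 1")
    case True
    then show ?thesis using card_le_from_poor_vertex deg3 by blast
  next
    case False
    then have "2 \<le> (\<Sum>w\<in>nbrs E v. excess w)" if "v \<in> V" "deg E v = 3" for v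
      using that by force
    then show ?thesis using discharging deg3 by (simp add: trans_le_add1)
  qed
  moreover have "2 * card E = 3 * card V + (\<Sum>v\<in>V. excess v)"
  proof -
    have "(\<Sum>v\<in>V. deg E v) = (\<Sum>v\<in>V. 3 + excess v)"
      using deg3 by (intro sum.cong) auto
    then show ?thesis using handshake by (simp add: sum.distrib)
  qed
  ultimately show ?thesis by linarith
qed

section \<open>A vertex of degree two\<close>

text \<open>In the proof, \<open>S\<close> consists of the vertices of degree 2 outside \<open>{r, a, b}\<close> with exactly one
  neighbour in \<open>{a, b}\<close>; \<open>a\<close> and \<open>b\<close> are the neighbours of \<open>r\<close>. Every other vertex outside has
  \<open>deg v + c v \<ge> 4\<close>, where \<open>c v\<close> counts its neighbours in \<open>{a, b}\<close>: for \<open>c v = 0\<close> this is the degree sum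
  inequality applied to \<open>v\<close> and \<open>r\<close>. So \<open>4 * n - 8 - card S \<le> 2 * e\<close>, and it remains to
  compensate for \<open>card S\<close> when it exceeds 2.\<close>

lemma edges_deg_2:
  assumes r: "r \<in> V" "deg E r = 2" and n: "4 \<le> card V"
  shows "5 * card V \<le> 3 * card E + 11"
proof -
  obtain a b where ab: "nbrs E r = {a, b}" "a \<noteq> b" using r(2) by (auto simp: card_2_iff)
  have inV: "a \<in> V" "b \<in> V" using nbrs_subset[of r] ab by auto
  have rn: "r \<noteq> a" "r \<noteq> b" using not_self_nbr[of r] ab by auto
  have rab: "r \<in> nbrs E a" "r \<in> nbrs E b" using nbrs_sym[of _ E r] ab by auto
  define Y where "Y = V - {r, a, b}"
  define c where "c v = card (nbrs E v \<inter> {a, b})" for v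
  define S where "S = {v \<in> Y. deg E v = 2 \<and> c v = 1}"
  have finY: "finite Y" "Y \<subseteq> V" "S \<subseteq> Y" "finite S" using fin_V by (auto simp: Y_def S_def)
  have cY: "card Y + 3 = card V"
  proof -
    have "card Y = card V - card {r, a, b}" unfolding Y_def
      using r inV by (intro card_Diff_subset) auto
    then show ?thesis using ab(2) rn n by simp
  qed
  have c_cases: "c v = (if a \<in> nbrs E v then 1 else 0) + (if b \<in> nbrs E v then 1 else 0)" for v
    using ab(2) by (auto simp: c_def Int_insert_right)
  have degab: "(\<Sum>v\<in>Y. c v) + 2 \<le> deg E a + deg E b"
  proof -
    have "(\<Sum>v\<in>Y. c v) = card (nbrs E a \<inter> Y) + card (nbrs E b \<inter> Y)"
      using sum_over_nbrs[OF finY(2), of "{a, b}" "\<lambda>_. 1"] inV ab(2) by (simp add: c_def)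
    moreover have inc: "card (nbrs E w \<inter> Y) + 1 \<le> deg E w" if "r \<in> nbrs E w" for w
    proof -
      have "card (nbrs E w \<inter> Y) < deg E w"
        using that fin_nbrs by (intro psubset_card_mono) (auto simp: Y_def)
      then show ?thesis by simp
    qed
    ultimately show ?thesis using inc[OF rab(1)] inc[OF rab(2)] by linarith
  qed
  have total: "4 + (\<Sum>v\<in>Y. g v) \<le> 2 * card E" if "\<And>v. v \<in> Y \<Longrightarrow> g v \<le> deg E v + c v" for g
  proof -
    have "(\<Sum>v\<in>Y. g v) \<le> (\<Sum>v\<in>Y. deg E v) + (\<Sum>v\<in>Y. c v)"
      using that by (simp add: sum_mono flip: sum.distrib)
    moreover have "(\<Sum>v\<in>V. deg E v) = (\<Sum>v\<in>{r, a, b}. deg E v) + (\<Sum>v\<in>Y. deg E v)"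
      unfolding Y_def using fin_V r inV by (subst sum.subset_diff[of "{r, a, b}" V]) auto
    moreover have "(\<Sum>v\<in>{r, a, b}. deg E v) = 2 + deg E a + deg E b"
      using rn ab(2) r(2) by simp
    ultimately show ?thesis using degab handshake by linarith
  qed
  have weight: "(if v \<in> S then 3 else 4) \<le> deg E v + c v" if v: "v \<in> Y" for v
  proof -
    have v': "v \<in> V" "v \<noteq> r" "v \<noteq> a" "v \<noteq> b" using v by (auto simp: Y_def)
    have d2: "2 \<le> deg E v" using v'(1) n by (intro deg_ge_2) auto
    show ?thesis
    proof (cases "c v = 0")
      case True
      then have "a \<notin> nbrs E v" "b \<notin> nbrs E v" by (auto simp: c_cases split: if_splits)
      then have "6 \<le> deg E r + deg E v"
        using v' r(1) ab by (intro deg_sum_ge_6) auto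
      then show ?thesis using r(2) by simp
    next
      case False
      then show ?thesis using d2 v by (auto simp: S_def)
    qed
  qed
  have sumS: "(\<Sum>v\<in>A. if v \<in> S then 3 else 4::nat) + card S = 4 * card A" if "S \<subseteq> A" "finite A" for A
  proof -
    have "(\<Sum>v\<in>A. if v \<in> S then 3 else 4::nat) + (\<Sum>v\<in>A. if v \<in> S then 1 else 0) = (\<Sum>v\<in>A. 4)"
      unfolding sum.distrib[symmetric] by (intro sum.cong) auto
    moreover have "(\<Sum>v\<in>A. if v \<in> S then 1 else 0::nat) = card S"
      using that by (simp add: sum.If_cases Int_absorb1)
    ultimately show ?thesis by simp
  qed
  have base: "4 * card V \<le> 2 * card E + card S + 8"
    using total[of "\<lambda>v. if v \<in> S then 3 else 4"] weight sumS[OF finY(3,1)] cY by simp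
  \<comment> \<open>If \<open>S\<close> hangs on one neighbour \<open>w\<close> of \<open>r\<close>, then \<open>deg w > card S\<close>, and adding the bound from
    \<open>G - w\<close> to \<open>base\<close> cancels \<open>card S\<close>.\<close>
  have one_sided: ?thesis if w: "w \<in> {a, b}" "S \<subseteq> nbrs E w" for w
  proof -
    have "r \<in> nbrs E w" "w \<in> V" using w rab inV by auto
    have "insert r S \<subseteq> nbrs E w" "r \<notin> S" using w \<open>r \<in> nbrs E w\<close> by (auto simp: S_def Y_def)
    then have "card S + 1 \<le> deg E w"
      using card_mono[OF fin_nbrs \<open>insert r S \<subseteq> nbrs E w\<close>] finY(4) by simp
    moreover have "card V + deg E w \<le> card E + 2"
      using \<open>w \<in> V\<close> r(1) w(1) rn by (intro edges_ge_deg) auto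
    ultimately show ?thesis using base by linarith
  qed
  show ?thesis
  proof (cases "S \<subseteq> nbrs E a \<or> S \<subseteq> nbrs E b")
    case True
    then show ?thesis using one_sided by blast
  next
    case False
    then obtain x y where x: "x \<in> S" "x \<notin> nbrs E b" and y: "y \<in> S" "y \<notin> nbrs E a" by blast
    show ?thesis
    proof (cases "card S \<le> 2")
      case True
      then show ?thesis using base n by linarith
    next
      case big: False
      have S: "deg E z = 2" "z \<in> V" "z \<noteq> r" "z \<noteq> a" "z \<noteq> b" "(a \<in> nbrs E z) = (b \<notin> nbrs E z)"
        if "z \<in> S" for z
        using that by (auto simp: S_def Y_def c_cases split: if_splits)
      have close: "w \<in> nbrs E z \<or> (\<exists>p. p \<in> nbrs E z \<and> p \<in> nbrs E w)"
        if "z \<in> S" "w \<in> S" "z \<noteq> w" for z w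
        using deg_sum_ge_6[of z w] S(1,2)[OF that(1)] S(1,2)[OF that(2)] that(3) by auto
      have xa: "a \<in> nbrs E x" "b \<notin> nbrs E x" and yb: "b \<in> nbrs E y" "a \<notin> nbrs E y"
        using x y S(6)[OF x(1)] S(6)[OF y(1)] nbrs_sym by metis+
      have xy: "x \<noteq> y" using xa yb by auto
      have two: "nbrs E z = {u, v}" if "deg E z = 2" "u \<in> nbrs E z" "v \<in> nbrs E z" "u \<noteq> v" for z u v
      proof -
        have "{u, v} = nbrs E z" using that fin_nbrs by (intro card_seteq) auto
        then show ?thesis ..
      qed
      \<comment> \<open>If \<open>x\<close> and \<open>y\<close> were adjacent, a third vertex of \<open>S\<close> would be at distance at least 3 from the one that
        hangs on the other side.\<close>
      have not_adj: "y \<notin> nbrs E x"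
      proof
        assume yx: "y \<in> nbrs E x"
        then have xy': "x \<in> nbrs E y" using nbrs_sym by metis
        have Nx: "nbrs E x = {a, y}" using S(1)[OF x(1)] S(4)[OF y(1)] xa yx by (intro two) auto
        have Ny: "nbrs E y = {b, x}" using S(1)[OF y(1)] S(5)[OF x(1)] yb xy' by (intro two) auto
        have "\<not> S \<subseteq> {x, y}"
          using big card_mono[of "{x, y}" S] xy by auto
        then obtain z where z: "z \<in> S" "z \<noteq> x" "z \<noteq> y" by blast
        have nz: "x \<notin> nbrs E z" "y \<notin> nbrs E z"
          using nbrs_sym[of _ E z] Nx Ny z S(4,5)[OF z(1)] by auto
        show False
        proof (cases "a \<in> nbrs E z")
          case True
          then have "b \<notin> nbrs E z" using S(6)[OF z(1)] by simp
          with close[OF z(1) y(1) z(3)] nz Ny show False by auto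
        next
          case False
          with close[OF z(1) x(1) z(2)] nz Nx show False by auto
        qed
      qed
      then obtain p where p: "p \<in> nbrs E x" "p \<in> nbrs E y" using close[OF x(1) y(1) xy] by blast
      have pab: "p \<noteq> a" "p \<noteq> b" using p xa yb by auto
      have Nx: "nbrs E x = {a, p}" using S(1)[OF x(1)] xa p pab by (intro two) auto
      have Ny: "nbrs E y = {b, p}" using S(1)[OF y(1)] yb p pab by (intro two) auto
      have xp: "x \<in> nbrs E p" "y \<in> nbrs E p" using p nbrs_sym by metis+
      have pr: "p \<noteq> r" using xp(1) ab S(4,5)[OF x(1)] by auto
      have pS: "p \<notin> S"
      proof
        assume pS: "p \<in> S"
        then have "nbrs E p = {x, y}" using S(1) xp xy by (intro two) auto
        then show False using S(6)[OF pS] S(4,5)[OF x(1)] S(4,5)[OF y(1)] by auto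
      qed
      \<comment> \<open>Each vertex of \<open>S\<close> hangs on the other side than one of \<open>x\<close> and \<open>y\<close>, and \<open>p\<close> is all that it can
        share with it.\<close>
      have hub: "S \<subseteq> nbrs E p"
      proof
        fix z assume z: "z \<in> S"
        have zp: "z \<noteq> p" using z pS by auto
        have "p \<in> nbrs E z"
        proof (cases "z = x \<or> z = y")
          case True
          then show ?thesis using p by auto
        next
          case False
          have nz: "x \<notin> nbrs E z" "y \<notin> nbrs E z"
            using nbrs_sym[of _ E z] Nx Ny zp S(4,5)[OF z] by auto
          show ?thesis
          proof (cases "a \<in> nbrs E z")
            case True
            then have "b \<notin> nbrs E z" using S(6)[OF z] by simp
            with close[OF z y(1)] False nz Ny show ?thesis by auto
          next
            case no_a: False
            with close[OF z x(1)] False nz Nx show ?thesis by auto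
          qed
        qed
        then show "z \<in> nbrs E p" using nbrs_sym by metis
      qed
      have pY: "p \<in> Y" using nbrs_subset[of x] p pab pr by (auto simp: Y_def)
      \<comment> \<open>Charging \<open>card S\<close> to \<open>p\<close> makes up for all of \<open>S\<close> but the 4 that \<open>p\<close> was charged before. So
        \<open>4 * n - 12 \<le> 2 * e\<close>, which is enough since \<open>r\<close>, \<open>a\<close>, \<open>b\<close>, \<open>p\<close> and \<open>S\<close> amount to at
        least 7 vertices.\<close>
      have "card S \<le> deg E p" using hub by (intro card_mono fin_nbrs)
      then have "4 + (\<Sum>v\<in>Y. if v = p then card S else if v \<in> S then 3 else 4) \<le> 2 * card E"
        using weight by (intro total) (simp add: trans_le_add1)
      moreover have "(\<Sum>v\<in>Y. if v = p then card S else if v \<in> S then 3 else 4)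
        = card S + (\<Sum>v\<in>Y - {p}. if v \<in> S then 3 else 4)"
        using finY(1) pY by (subst sum.remove[of Y p]) (auto intro!: sum.cong)
      moreover have "(\<Sum>v\<in>Y - {p}. if v \<in> S then 3 else 4::nat) + card S = 4 * card (Y - {p})"
        using finY pS by (intro sumS) auto
      moreover have "card (Y - {p}) + 1 = card Y"
        using card.remove[OF finY(1) pY] by simp
      moreover have "card S \<le> card (Y - {p})" using finY pS by (intro card_mono) auto
      ultimately show ?thesis using big cY by linarith
    qed
  qed
qed

lemma edge_bound: "5 * card V \<le> 3 * card E + 11"
proof (cases "card V \<le> 3")
  case True
  then show ?thesis using connected_card_le by linarith
next
  case False
  then have d2: "2 \<le> deg E v" if "v \<in> V" for v using that by (intro deg_ge_2) auto
  show ?thesis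
  proof (cases "\<exists>r\<in>V. deg E r = 2")
    case True
    then show ?thesis using edges_deg_2 False by auto
  next
    case no2: False
    then have "3 \<le> deg E v" if "v \<in> V" for v using d2[OF that] that by force
    then show ?thesis by (rule edges_min_deg_3)
  qed
qed

end

theorem theorem4:
  fixes V :: "'a set" and E :: "'a set set" and n :: nat
  assumes "connected_graph V E"
    and "card V = n"
    and "class_0 V E"
    and "graph_diameter V E \<ge> 3"
  shows "real (card E) \<ge> 5 / 3 * real n - 11 / 3"
proof -
  interpret class_0_graph V E
    using assms(1,3) by unfold_locales
  have "real (5 * card V) \<le> real (3 * card E + 11)"
    using edge_bound by (rule of_nat_mono)
  then show ?thesis using assms(2) by simp
qed

end
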